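(* For $\boldsymbol s=(s_1,s_2,s_3)$ in a neighborhood of $\boldsymbol s_o=(3,3,1)$, the following identities of power series in $t$ hold: $$\mathcal F_1(\boldsymbol s,t)=-\sum_{k=0}^\infty\left(\frac{\alpha_1a_++\alpha_0}{a_+^{k+1}(2\gamma_2a_++\gamma_1)}+\frac{\alpha_1a_-+\alpha_0}{a_-^{k+1}(2\gamma_2a_-+\gamma_1)}\right)t^{4k+1},$$ $$\mathcal F_2(\boldsymbol s,t)=-\sum_{k=0}^\infty\left(\frac{\beta_1a_++\beta_0}{a_+^{k+1}(2\gamma_2a_++\gamma_1)}+\frac{\beta_1a_-+\beta_0}{a_-^{k+1}(2\gamma_2a_-+\gamma_1)}\right)t^{4k+3}.$$
   Context: The odd $*$-Fibonacci polynomials $F_{2n+1}\in\mathbb Z[s_1,s_2,s_3]$, $n\ge0$, are defined by $F_1=s_1$, $F_3=s_1^2-s_2$, and $F_{2n+3}=g_nF_{2n+1}-s_3F_{2n-1}$ for $n\ge1$, where $g_n=s_2$ if $n$ is odd and $g_n=s_1$ if $n$ is even. Put $$\mathcal F_1(\boldsymbol s,t)=\sum_{k\ge0}F_{4k+1}(\boldsymbol s)t^{4k+1},\qquad \mathcal F_2(\boldsymbol s,t)=\sum_{k\ge0}F_{4k+3}(\boldsymbol s)t^{4k+3}.$$ Constants depending on $\boldsymbol s$: $\alpha_1=s_1s_3-s_2^2$, $\alpha_0=s_1$, $\beta_1=-s_2s_3$, $\beta_0=s_1^2-s_2$, $\gamma_2=s_3^2$, $\gamma_1=2s_3-s_1s_2$,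 and $$a_\pm=a_\pm(\boldsymbol s)=\frac{s_1s_2-2s_3\pm(s_1^2s_2^2-4s_1s_2s_3)^{1/2}}{2s_3^2},$$ the roots of $s_3^2u^2+(2s_3-s_1s_2)u+1$, where the branch of the square root near $\boldsymbol s_o$ is the one with $a_\pm(\boldsymbol s_o)=\frac{7\pm3\sqrt5}{2}$. *)

theory Defs
  imports "HOL-Analysis.Analysis" "HOL-Computational_Algebra.Formal_Power_Series"
begin

text \<open>
  \<open>oddF s n\<close> is the value \<open>F\<^bsub>2n+1\<^esub>(s)\<close> of the odd *-Fibonacci polynomial with index \<open>2n+1\<close>.
  The point \<open>s\<close> may lie in any commutative ring; the polynomial itself is the value at the generic
  point \<open>(s\<^sub>1, s\<^sub>2, s\<^sub>3)\<close> of \<open>\<int>[s\<^sub>1, s\<^sub>2, s\<^sub>3]\<close>, and \<open>oddF_hom\<close> says that specializing the polynomial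
  gives the value.
\<close>

fun gcoeff :: "'a \<times> 'a \<times> 'a \<Rightarrow> nat \<Rightarrow> 'a" where
  "gcoeff (s1, s2, s3) n = (if odd n then s2 else s1)"

fun oddF :: "'a::comm_ring_1 \<times> 'a \<times> 'a \<Rightarrow> nat \<Rightarrow> 'a" where
  "oddF (s1, s2, s3) 0 = s1"
| "oddF (s1, s2, s3) (Suc 0) = s1\<^sup>2 - s2"
| "oddF (s1, s2, s3) (Suc (Suc m)) =
     gcoeff (s1, s2, s3) (Suc m) * oddF (s1, s2, s3) (Suc m) - s3 * oddF (s1, s2, s3) m"

lemma oddF_hom:
  fixes h :: "'a::comm_ring_1 \<Rightarrow> 'b::comm_ring_1"
  assumes "\<And>x y. h (x - y) = h x - h y" and "\<And>x y. h (x * y) = h x * h y"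
  shows "h (oddF (s1, s2, s3) n) = oddF (h s1, h s2, h s3) n"
  by (induction n rule: induct_nat_012) (auto simp: assms power2_eq_square)

text \<open>The infinite sums below are limits in the \<open>t\<close>-adic topology on formal power series.\<close>

lemma fps_sums_progression:
  fixes c :: "nat \<Rightarrow> 'a::comm_ring_1"
  assumes "r < 4"
  shows "(\<lambda>k. fps_const (c k) * fps_X ^ (4*k + r)) sums
           Abs_fps (\<lambda>m. if m mod 4 = r then c (m div 4) else 0)"
  unfolding sums_def
proof (rule tendsto_fpsI)
  fix m
  have eq: "(m = 4*k + r) = (k = m div 4 \<and> m mod 4 = r)" for k
    using assms by auto
  have "fps_nth (\<Sum>k<N. fps_const (c k) * fps_X ^ (4*k + r)) m =
          fps_nth (Abs_fps (\<lambda>m. if m mod 4 = r then c (m div 4) else 0)) m" if "N > m" for N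
  proof -
    have "fps_nth (\<Sum>k<N. fps_const (c k) * fps_X ^ (4*k + r)) m
            = (\<Sum>k<N. if k = m div 4 then (if m mod 4 = r then c k else 0) else 0)"
      unfolding fps_sum_nth by (rule sum.cong) (auto simp: fps_X_power_nth eq)
    also have "\<dots> = (if m mod 4 = r then c (m div 4) else 0)"
      using that by (subst sum.delta) auto
    finally show ?thesis by simp
  qed
  then show "\<forall>\<^sub>F N in sequentially. fps_nth (\<Sum>k<N. fps_const (c k) * fps_X ^ (4*k + r)) m =
          fps_nth (Abs_fps (\<lambda>m. if m mod 4 = r then c (m div 4) else 0)) m"
    by (rule eventually_mono[OF eventually_gt_at_top[of m]])
qed

definition genF1 :: "'a::comm_ring_1 \<times> 'a \<times> 'a \<Rightarrow> 'a fps" where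
  "genF1 s = (\<Sum>k. fps_const (oddF s (2*k)) * fps_X ^ (4*k + 1))"

definition genF2 :: "'a::comm_ring_1 \<times> 'a \<times> 'a \<Rightarrow> 'a fps" where
  "genF2 s = (\<Sum>k. fps_const (oddF s (2*k + 1)) * fps_X ^ (4*k + 3))"

type_synonym cpoint = "complex \<times> complex \<times> complex"

fun alpha1 :: "cpoint \<Rightarrow> complex" where "alpha1 (s1, s2, s3) = s1 * s3 - s2\<^sup>2"
fun alpha0 :: "cpoint \<Rightarrow> complex" where "alpha0 (s1, s2, s3) = s1"
fun beta1 :: "cpoint \<Rightarrow> complex" where "beta1 (s1, s2, s3) = - s2 * s3"
fun beta0 :: "cpoint \<Rightarrow> complex" where "beta0 (s1, s2, s3) = s1\<^sup>2 - s2"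
fun gamma2 :: "cpoint \<Rightarrow> complex" where "gamma2 (s1, s2, s3) = s3\<^sup>2"
fun gamma1 :: "cpoint \<Rightarrow> complex" where "gamma1 (s1, s2, s3) = 2 * s3 - s1 * s2"

fun radicand :: "cpoint \<Rightarrow> complex" where
  "radicand (s1, s2, s3) = s1\<^sup>2 * s2\<^sup>2 - 4 * s1 * s2 * s3"

text \<open>In \<open>aplus\<close> and \<open>aminus\<close>, the function \<open>\<rho>\<close> is the chosen branch of the square root of \<open>radicand\<close>.\<close>

fun aplus :: "(cpoint \<Rightarrow> complex) \<Rightarrow> cpoint \<Rightarrow> complex" where
  "aplus \<rho> (s1, s2, s3) = (s1 * s2 - 2 * s3 + \<rho> (s1, s2, s3)) / (2 * s3\<^sup>2)"

fun aminus :: "(cpoint \<Rightarrow> complex) \<Rightarrow> cpoint \<Rightarrow> complex" where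
  "aminus \<rho> (s1, s2, s3) = (s1 * s2 - 2 * s3 - \<rho> (s1, s2, s3)) / (2 * s3\<^sup>2)"

definition s_o :: cpoint where "s_o = (3, 3, 1)"

definition sqrt_branch :: "(cpoint \<Rightarrow> complex) \<Rightarrow> bool" where
  "sqrt_branch \<rho> \<longleftrightarrow>
     (\<exists>V. open V \<and> s_o \<in> V \<and> continuous_on V \<rho> \<and> (\<forall>s\<in>V. (\<rho> s)\<^sup>2 = radicand s)) \<and>
     aplus \<rho> s_o = (7 + 3 * complex_of_real (sqrt 5)) / 2 \<and>
     aminus \<rho> s_o = (7 - 3 * complex_of_real (sqrt 5)) / 2"

text \<open>Such a branch exists; the principal one is an example.\<close>

lemma sqrt_branch_csqrt: "sqrt_branch (\<lambda>s. csqrt (radicand s))"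
proof -
  have rad: "radicand = (\<lambda>s. (fst s)\<^sup>2 * (fst (snd s))\<^sup>2 - 4 * fst s * fst (snd s) * snd (snd s))"
    by (auto simp: fun_eq_iff)
  have cont: "continuous_on UNIV radicand"
    unfolding rad by (intro continuous_intros)
  define V where "V = radicand -` (- \<real>\<^sub>\<le>\<^sub>0)"
  have "open V"
    unfolding V_def using cont by (intro open_vimage) auto
  moreover have "radicand s_o = 45"
    by (simp add: s_o_def)
  then have "s_o \<in> V"
    by (simp add: V_def complex_nonpos_Reals_iff)
  moreover have "continuous_on V (\<lambda>s. csqrt (radicand s))"
    by (rule continuous_on_compose2[OF continuous_on_csqrt continuous_on_subset[OF cont]])
       (auto simp: V_def)
  moreover have "csqrt 45 = 3 * complex_of_real (sqrt 5)"
    by (rule csqrt_unique) (simp_all add: power_mult_distrib flip: of_real_power)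
  ultimately show ?thesis
    unfolding sqrt_branch_def by (auto simp: s_o_def)
qed

end

theory Submission
  imports Defs
begin

text \<open>
  Eliminating one of the two interlaced sequences \<open>x k = F\<^bsub>4k+1\<^esub>\<close>, \<open>y k = F\<^bsub>4k+3\<^esub>\<close> from the
  recurrences \<open>x (k+1) = s\<^sub>2 y k - s\<^sub>3 x k\<close> and \<open>y (k+1) = s\<^sub>1 x (k+1) - s\<^sub>3 y k\<close> shows that both
  satisfy one and the same recurrence with constant coefficients,
  \<open>z (k+2) + \<gamma>\<^sub>1 z (k+1) + \<gamma>\<^sub>2 z k = 0\<close>.  Its generating function in \<open>u\<close> is therefore
  \<open>(z 0 + (z 1 + \<gamma>\<^sub>1 z 0) u) / (1 + \<gamma>\<^sub>1 u + \<gamma>\<^sub>2 u\<^sup>2)\<close>, whose numerator is \<open>\<alpha>\<^sub>0 + \<alpha>\<^sub>1 u\<close> for \<open>x\<close> and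
  \<open>\<beta>\<^sub>0 + \<beta>\<^sub>1 u\<close> for \<open>y\<close>.  The claimed coefficients are those of its partial fraction decomposition
  at the roots \<open>a\<^sub>\<plusminus>\<close> of the denominator (\<open>binet_partial_fractions\<close>).

  The decomposition needs \<open>\<gamma>\<^sub>2 \<noteq> 0\<close> and \<open>a\<^sub>+ \<noteq> a\<^sub>-\<close>, that is \<open>s\<^sub>3 \<noteq> 0\<close> and a nonzero radicand.  These
  are open conditions, and they hold at \<open>s\<^sub>o\<close>, where \<open>s\<^sub>3 = 1\<close> and the radicand is 45; the neighborhood
  is the part of the domain of the branch where they hold.
\<close>

text \<open>
  The roots enter through Vieta's formulas, so that \<open>g2 * (u - a) * (u - b) = 1 + g1 * u + g2 * u\<^sup>2\<close>.
  The right-hand side solves the recurrence because the reciprocal of a root of this polynomial is a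
  root of the characteristic polynomial \<open>X\<^sup>2 + g1 * X + g2\<close>; it then remains to compare the first two
  terms.
\<close>

lemma binet_partial_fractions:
  fixes x :: "nat \<Rightarrow> 'a::field"
  assumes rec: "\<And>k. x (Suc (Suc k)) = - g1 * x (Suc k) - g2 * x k"
    and prod_roots: "g2 * (a * b) = 1" and sum_roots: "g1 = - g2 * (a + b)" and "a \<noteq> b"
    and c0: "c0 = x 0" and c1: "c1 = x 1 + g1 * x 0"
  shows "x k = - ((c1 * a + c0) / (a ^ (k + 1) * (2 * g2 * a + g1)) +
                  (c1 * b + c0) / (b ^ (k + 1) * (2 * g2 * b + g1)))"
proof -
  have nz: "g2 \<noteq> 0" "a \<noteq> 0" "b \<noteq> 0" "a - b \<noteq> 0"
    using prod_roots \<open>a \<noteq> b\<close> by auto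
  \<comment> \<open>The derivative of the polynomial at its two simple roots.\<close>
  have deriv: "2 * g2 * a + g1 = g2 * (a - b)" "2 * g2 * b + g1 = - (g2 * (a - b))"
    by (simp_all add: sum_roots algebra_simps)
  have recip: "1 / a = g2 * b" "1 / b = g2 * a"
    using nz prod_roots by (simp_all add: field_simps)
  define P where "P = (c1 * a + c0) / (g2 * (a - b))"
  define Q where "Q = (c1 * b + c0) / (g2 * (a - b))"
  \<comment> \<open>Binet's formula, with the reciprocals of the roots written as \<open>g2 * a\<close> and \<open>g2 * b\<close>.\<close>
  have "x k = Q * (g2 * a) ^ Suc k - P * (g2 * b) ^ Suc k"
  proof (induction k rule: induct_nat_012)
    case 0
    have "Q * (g2 * a) - P * (g2 * b) = c0 * (g2 * (a - b)) / (g2 * (a - b))"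
      unfolding P_def Q_def times_divide_eq_left diff_divide_distrib[symmetric]
      by (simp add: algebra_simps)
    also have "\<dots> = c0"
      using nz by simp
    finally have "Q * (g2 * a) - P * (g2 * b) = c0" .
    then show ?case by (simp add: c0)
  next
    case 1
    have "Q * (g2 * a)\<^sup>2 - P * (g2 * b)\<^sup>2 =
        (c1 * (g2 * (a * b)) + c0 * (g2 * (a + b))) * (g2 * (a - b)) / (g2 * (a - b))"
      unfolding P_def Q_def times_divide_eq_left diff_divide_distrib[symmetric]
      by (simp add: algebra_simps power2_eq_square)
    also have "\<dots> = c1 * (g2 * (a * b)) + c0 * (g2 * (a + b))"
      using nz by simp
    also have "\<dots> = x 1"
      unfolding prod_roots c0 c1 sum_roots by (simp add: algebra_simps)
    finally show ?case by (simp add: power2_eq_square)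
  next
    case (ge2 n)
    have char: "(g2 * r)\<^sup>2 = - g1 * (g2 * r) - g2" if "r = a \<or> r = b" for r
    proof -
      have "g2 * (g2 * (a * b)) = g2"
        by (simp add: prod_roots)
      then show ?thesis
        using that unfolding sum_roots by (auto simp: algebra_simps power2_eq_square)
    qed
    have step: "(g2 * r) ^ Suc (Suc (Suc n)) = - g1 * (g2 * r) ^ Suc (Suc n) - g2 * (g2 * r) ^ Suc n"
      if "r = a \<or> r = b" for r
    proof -
      have "(g2 * r) ^ Suc (Suc (Suc n)) = (g2 * r)\<^sup>2 * (g2 * r) ^ Suc n"
        by (simp only: power_Suc power2_eq_square mult.assoc)
      then show ?thesis
        unfolding char[OF that] by (simp add: algebra_simps)
    qed
    show ?case
      unfolding rec ge2 step[OF disjI1[OF refl]] step[OF disjI2[OF refl]]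
      by (simp only: algebra_simps simp_thms)
  qed
  also have "\<dots> = - ((c1 * a + c0) / (a ^ (k + 1) * (2 * g2 * a + g1)) +
                  (c1 * b + c0) / (b ^ (k + 1) * (2 * g2 * b + g1)))"
    unfolding deriv P_def Q_def recip[symmetric]
    by (simp add: power_one_over mult.commute)
  finally show ?thesis .
qed

lemma suminf_progression_minus:
  fixes x c :: "nat \<Rightarrow> 'a::comm_ring_1"
  assumes "\<And>k. x k = - c k" and "r < 4"
  shows "(\<Sum>k. fps_const (x k) * fps_X ^ (4*k + r)) = - (\<Sum>k. fps_const (c k) * fps_X ^ (4*k + r))"
  unfolding sums_unique[OF fps_sums_progression[OF \<open>r < 4\<close>], symmetric]
  by (rule fps_ext) (simp add: assms)

text \<open>
  The two-step recurrence is the same for both parities of \<open>n\<close>: the coefficients \<open>s1\<close> and \<open>s2\<close>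
  alternate, so that two consecutive steps of the defining recurrence multiply to \<open>s1 * s2\<close>,
  whichever comes first.
\<close>

lemma oddF_two_step:
  "oddF (s1, s2, s3) (Suc (Suc (Suc (Suc n)))) =
     - (2 * s3 - s1 * s2) * oddF (s1, s2, s3) (Suc (Suc n)) - s3\<^sup>2 * oddF (s1, s2, s3) n"
  by (simp add: algebra_simps power2_eq_square)

lemma continuous_on_radicand: "continuous_on UNIV radicand"
proof -
  have rad: "radicand = (\<lambda>s. (fst s)\<^sup>2 * (fst (snd s))\<^sup>2 - 4 * fst s * fst (snd s) * snd (snd s))"
    by (auto simp: fun_eq_iff)
  show ?thesis
    unfolding rad by (intro continuous_intros)
qed

lemma aplus_aminus_vieta:
  assumes "s3 \<noteq> 0" and "(\<rho> (s1, s2, s3))\<^sup>2 = radicand (s1, s2, s3)"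
  defines "a \<equiv> aplus \<rho> (s1, s2, s3)" and "b \<equiv> aminus \<rho> (s1, s2, s3)"
  shows "gamma2 (s1, s2, s3) * (a * b) = 1"
    and "gamma1 (s1, s2, s3) = - gamma2 (s1, s2, s3) * (a + b)"
    and "radicand (s1, s2, s3) \<noteq> 0 \<Longrightarrow> a \<noteq> b"
proof -
  have "(s1 * s2 - 2 * s3 + \<rho> (s1, s2, s3)) * (s1 * s2 - 2 * s3 - \<rho> (s1, s2, s3))
          = (s1 * s2 - 2 * s3)\<^sup>2 - (\<rho> (s1, s2, s3))\<^sup>2"
    by (simp add: algebra_simps power2_eq_square)
  also have "\<dots> = 4 * s3\<^sup>2"
    unfolding assms(2) by (simp add: algebra_simps power2_eq_square)
  finally show "gamma2 (s1, s2, s3) * (a * b) = 1"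
    using assms(1) by (simp add: a_def b_def power2_eq_square)
  show "gamma1 (s1, s2, s3) = - gamma2 (s1, s2, s3) * (a + b)"
    using assms(1) by (simp add: a_def b_def field_simps power2_eq_square)
  assume "radicand (s1, s2, s3) \<noteq> 0"
  then have "\<rho> (s1, s2, s3) \<noteq> 0"
    using assms(2) by auto
  then show "a \<noteq> b"
    using assms(1) by (simp add: a_def b_def)
qed

theorem theorem8p11:
  fixes \<rho> :: "complex \<times> complex \<times> complex \<Rightarrow> complex"
  assumes "sqrt_branch \<rho>"
  shows "\<exists>U. open U \<and> s_o \<in> U \<and> (\<forall>s\<in>U.
    genF1 s =
      - (\<Sum>k. fps_const
          ((alpha1 s * aplus \<rho> s + alpha0 s) /
             (aplus \<rho> s ^ (k + 1) * (2 * gamma2 s * aplus \<rho> s + gamma1 s)) +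
           (alpha1 s * aminus \<rho> s + alpha0 s) /
             (aminus \<rho> s ^ (k + 1) * (2 * gamma2 s * aminus \<rho> s + gamma1 s)))
          * fps_X ^ (4*k + 1)) \<and>
    genF2 s =
      - (\<Sum>k. fps_const
          ((beta1 s * aplus \<rho> s + beta0 s) /
             (aplus \<rho> s ^ (k + 1) * (2 * gamma2 s * aplus \<rho> s + gamma1 s)) +
           (beta1 s * aminus \<rho> s + beta0 s) /
             (aminus \<rho> s ^ (k + 1) * (2 * gamma2 s * aminus \<rho> s + gamma1 s)))
          * fps_X ^ (4*k + 3)))" (is "\<exists>U. open U \<and> s_o \<in> U \<and> (\<forall>s\<in>U. ?F1 s \<and> ?F2 s)")
proof -
  obtain V where V: "open V" "s_o \<in> V" "\<And>s. s \<in> V \<Longrightarrow> (\<rho> s)\<^sup>2 = radicand s"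
    using assms unfolding sqrt_branch_def by blast
  define U where "U = V \<inter> radicand -` (- {0}) \<inter> (\<lambda>s. snd (snd s)) -` (- {0})"
  have "open U"
    unfolding U_def using V(1) continuous_on_radicand
    by (intro open_Int open_vimage) (auto intro!: continuous_intros)
  moreover have "s_o \<in> U"
    using V(2) by (simp add: U_def s_o_def)
  moreover have "?F1 s \<and> ?F2 s" if "s \<in> U" for s
  proof -
    obtain s1 s2 s3 where s: "s = (s1, s2, s3)"
      by (cases s)
    have "s3 \<noteq> 0" "radicand s \<noteq> 0" "(\<rho> s)\<^sup>2 = radicand s"
      using that V(3) by (auto simp: U_def s)
    note vieta = aplus_aminus_vieta[where \<rho> = \<rho>, OF this(1) this(3)[unfolded s], folded s]
    have rec: "oddF s (Suc (Suc (Suc (Suc n)))) =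
        - gamma1 s * oddF s (Suc (Suc n)) - gamma2 s * oddF s n" for n
      unfolding s gamma1.simps gamma2.simps by (rule oddF_two_step)
    note binet = binet_partial_fractions[OF _ vieta(1,2) vieta(3)[OF \<open>radicand s \<noteq> 0\<close>]]
    have "?F1 s"
      unfolding genF1_def
    proof (rule suminf_progression_minus[OF binet])
      show "oddF s (2 * Suc (Suc k)) = - gamma1 s * oddF s (2 * Suc k) - gamma2 s * oddF s (2 * k)" for k
        using rec[of "2 * k"] by simp
    qed (simp_all add: s numeral_2_eq_2 algebra_simps)
    moreover have "?F2 s"
      unfolding genF2_def
    proof (rule suminf_progression_minus[OF binet])
      show "oddF s (2 * Suc (Suc k) + 1) =
          - gamma1 s * oddF s (2 * Suc k + 1) - gamma2 s * oddF s (2 * k + 1)" for k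
        using rec[of "2 * k + 1"] by simp
    qed (simp_all add: s numeral_3_eq_3 algebra_simps power2_eq_square)
    ultimately show ?thesis ..
  qed
  ultimately show ?thesis
    by blast
qed

end
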